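(* Let $H^2$ be a finite closed two-manifold. If for every one-sphere $S^1$ belonging to $H^2$ there is a two-disk $D^2$ belonging to $H^2$ such that $S^1=\partial D^2$, then $H^2$ is a two-sphere.
   Context: A digital space is a simple undirected graph with a finite or countable set of points (vertices). Subspaces are induced subgraphs; $H\subseteq G$ ("$H$ belongs to $G$") means $H$ is an induced subgraph of $G$. The rim $O(v)$ of a point $v$ is the subspace induced on the neighbors of $v$ (not containing $v$). $G-v$ is $G$ with the point $v$ deleted. Contractible graphs and contractible transformations: the one-point graph is contractible; the contractible transformations of a graph are (1) deleting a point $v$ with $O(v)$ contractible, (2) gluing a new point $v$ whose rim $O(v)$ is a contractible induced subgraph, (3) deleting an edge $(uv)$ with $O(u)\cap O(v)$ contractible, (4) adding an edge between non-adjacent points $u,v$ with $O(u)\cap O(v)$ contractible. A graph is contractible if it can be converted to a single point by a finite sequence of contractible transformations. Disks, spheres and manifolds are defined recursively. A 0-disk is a single point; a 0-sphere is the graph $S^0(a,b)$ with two non-adjacent points $a,b$. A 1-sphere is a finite connected graph in which the rim of each point is a 0-sphere. A 1-disk is a graph $S^1-v$ with $S^1$ a 1-sphere, $v\in S^1$. For $n\ge 1$: a closed $n$-manifold is a connected digital space in which the rim of every point is an $(n-1)$-sphere. An $n$-manifold with boundary is a connected space $N$ such that $N=M-v$ (up to isomorphism) for a closed $n$-manifold $M$ and a point $v\in M$; its boundary is $\partial N=O(v)$ and its interior is $\mathrm{Int}N=N-\partial N$. An $n$-disk is an $n$-manifold with boundary that is a contractible graph. For $n\ge 2$, an $n$-sphere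 is a graph $D\#C$ obtained from two $n$-disks $D,C$ with isomorphic boundaries by identifying each point of $\partial D$ with its counterpart in $\partial C$ under an isomorphism. *)

theory Defs
  imports "HOL-Library.Countable_Set" "HOL-Library.Infinite_Typeclass"
begin

record 'a graph =
  verts :: "'a set"
  edges :: "'a set set"

definition digital_space :: "'a graph \<Rightarrow> bool" where
  "digital_space G \<longleftrightarrow> countable (verts G) \<and> (\<forall>e\<in>edges G. e \<subseteq> verts G \<and> card e = 2)"

definition adjacent :: "'a graph \<Rightarrow> 'a \<Rightarrow> 'a \<Rightarrow> bool" where
  "adjacent G u v \<longleftrightarrow> {u, v} \<in> edges G"

definition nbrs :: "'a graph \<Rightarrow> 'a \<Rightarrow> 'a set" where
  "nbrs G v = {u \<in> verts G. adjacent G v u}"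

definition induced :: "'a graph \<Rightarrow> 'a set \<Rightarrow> 'a graph" where
  "induced G W = \<lparr>verts = verts G \<inter> W, edges = {e \<in> edges G. e \<subseteq> W}\<rparr>"

definition belongs_to :: "'a graph \<Rightarrow> 'a graph \<Rightarrow> bool" where
  "belongs_to H G \<longleftrightarrow> verts H \<subseteq> verts G \<and> H = induced G (verts H)"

definition rim :: "'a graph \<Rightarrow> 'a \<Rightarrow> 'a graph" where
  "rim G v = induced G (nbrs G v)"

definition common_rim :: "'a graph \<Rightarrow> 'a \<Rightarrow> 'a \<Rightarrow> 'a graph" where
  "common_rim G u v = induced G (nbrs G u \<inter> nbrs G v)"

definition delete_point :: "'a graph \<Rightarrow> 'a \<Rightarrow> 'a graph" where
  "delete_point G v = induced G (verts G - {v})"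

definition add_point :: "'a graph \<Rightarrow> 'a \<Rightarrow> 'a set \<Rightarrow> 'a graph" where
  "add_point G v W = \<lparr>verts = insert v (verts G), edges = edges G \<union> {{v, w} | w. w \<in> W}\<rparr>"

definition delete_edge :: "'a graph \<Rightarrow> 'a \<Rightarrow> 'a \<Rightarrow> 'a graph" where
  "delete_edge G u v = \<lparr>verts = verts G, edges = edges G - {{u, v}}\<rparr>"

definition add_edge :: "'a graph \<Rightarrow> 'a \<Rightarrow> 'a \<Rightarrow> 'a graph" where
  "add_edge G u v = \<lparr>verts = verts G, edges = insert {u, v} (edges G)\<rparr>"

text \<open>The empty graph does not count as connected.\<close>

definition connected_graph :: "'a graph \<Rightarrow> bool" where
  "connected_graph G \<longleftrightarrow>
     verts G \<noteq> {} \<and> (\<forall>u\<in>verts G. \<forall>v\<in>verts G. (adjacent G)\<^sup>*\<^sup>* u v)"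

definition graph_iso :: "('a \<Rightarrow> 'b) \<Rightarrow> 'a graph \<Rightarrow> 'b graph \<Rightarrow> bool" where
  "graph_iso f G H \<longleftrightarrow> bij_betw f (verts G) (verts H) \<and> edges H = (\<lambda>e. f ` e) ` edges G"

definition isomorphic :: "'a graph \<Rightarrow> 'b graph \<Rightarrow> bool" where
  "isomorphic G H \<longleftrightarrow> (\<exists>f. graph_iso f G H)"

definition one_point :: "'a graph \<Rightarrow> bool" where
  "one_point G \<longleftrightarrow> (\<exists>v. G = \<lparr>verts = {v}, edges = {}\<rparr>)"

text \<open>
  Contractible graphs and contractible transformations refer to each other; the intended
  notions are the least ones closed under the rules. The point type is required to be infinite
  so that it always offers a new point to glue to a finite graph; for the same reason
  every finite or countable space, and a one-point extension of it, has an isomorphic copy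
  on the type, so that no notion below is affected by a lack of points.
\<close>

inductive contractible_graph :: "'a::infinite graph \<Rightarrow> bool"
  and contractible_trans :: "'a::infinite graph \<Rightarrow> 'a graph \<Rightarrow> bool"
where
  point: "one_point G \<Longrightarrow> contractible_graph G"
| step: "contractible_trans G G' \<Longrightarrow> contractible_graph G' \<Longrightarrow> contractible_graph G"
| delete_point: "digital_space G \<Longrightarrow> v \<in> verts G \<Longrightarrow> contractible_graph (rim G v)
    \<Longrightarrow> contractible_trans G (delete_point G v)"
| glue_point: "digital_space G \<Longrightarrow> v \<notin> verts G \<Longrightarrow> W \<subseteq> verts G \<Longrightarrow> contractible_graph (induced G W)
    \<Longrightarrow> contractible_trans G (add_point G v W)"
| delete_edge: "digital_space G \<Longrightarrow> adjacent G u v \<Longrightarrow> contractible_graph (common_rim G u v)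
    \<Longrightarrow> contractible_trans G (delete_edge G u v)"
| add_edge: "digital_space G \<Longrightarrow> u \<in> verts G \<Longrightarrow> v \<in> verts G \<Longrightarrow> u \<noteq> v \<Longrightarrow> \<not> adjacent G u v
    \<Longrightarrow> contractible_graph (common_rim G u v) \<Longrightarrow> contractible_trans G (add_edge G u v)"

text \<open>
  The graph \<open>D#C\<close>: the disjoint union of \<open>D\<close> and \<open>C\<close> in which every \<open>x \<in> B\<close> is identified with
  \<open>h x\<close>. The points of \<open>D\<close> serve as representatives of the identified pairs, and \<open>glue_map\<close>
  sends a point of \<open>C\<close> to its representative.
\<close>

definition glue_map :: "'a set \<Rightarrow> ('a \<Rightarrow> 'b) \<Rightarrow> 'b \<Rightarrow> 'a + 'b" where
  "glue_map B h y = (if y \<in> h ` B then Inl (inv_into B h y) else Inr y)"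

definition glue :: "'a graph \<Rightarrow> 'b graph \<Rightarrow> 'a set \<Rightarrow> ('a \<Rightarrow> 'b) \<Rightarrow> ('a + 'b) graph" where
  "glue D C B h =
     \<lparr>verts = Inl ` verts D \<union> glue_map B h ` verts C,
      edges = (\<lambda>e. Inl ` e) ` edges D \<union> (\<lambda>e. glue_map B h ` e) ` edges C\<rparr>"

text \<open>
  \<open>bounded_manifold n N B\<close>: \<open>N\<close> is an \<open>n\<close>-manifold with boundary and \<open>\<partial>N = B\<close>, where
  \<open>\<partial>N\<close> is the copy in \<open>N\<close> of the rim of the point deleted from the closed manifold.
  \<open>n\<close>-manifolds, closed or with boundary, exist only for \<open>n \<ge> 1\<close>.
\<close>

function (sequential) digital_sphere :: "nat \<Rightarrow> 'a::infinite graph \<Rightarrow> bool"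
  and closed_manifold :: "nat \<Rightarrow> 'a::infinite graph \<Rightarrow> bool"
  and bounded_manifold :: "nat \<Rightarrow> 'a::infinite graph \<Rightarrow> 'a graph \<Rightarrow> bool"
  and digital_disk :: "nat \<Rightarrow> 'a::infinite graph \<Rightarrow> bool"
where
  "digital_sphere 0 G \<longleftrightarrow> (\<exists>a b. a \<noteq> b \<and> G = \<lparr>verts = {a, b}, edges = {}\<rparr>)"
| "digital_sphere (Suc 0) G \<longleftrightarrow>
     digital_space G \<and> finite (verts G) \<and> connected_graph G \<and>
     (\<forall>v\<in>verts G. digital_sphere 0 (rim G v))"
| "digital_sphere (Suc (Suc n)) G \<longleftrightarrow>
     (\<exists>D C BD BC h.
        digital_disk (Suc (Suc n)) D \<and> bounded_manifold (Suc (Suc n)) D BD \<and>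
        digital_disk (Suc (Suc n)) C \<and> bounded_manifold (Suc (Suc n)) C BC \<and>
        graph_iso h BD BC \<and> isomorphic (glue D C (verts BD) h) G)"
| "closed_manifold 0 M \<longleftrightarrow> False"
| "closed_manifold (Suc n) M \<longleftrightarrow>
     digital_space M \<and> connected_graph M \<and> (\<forall>v\<in>verts M. digital_sphere n (rim M v))"
| "bounded_manifold n N B \<longleftrightarrow>
     connected_graph N \<and>
     (\<exists>M v f. closed_manifold n M \<and> v \<in> verts M \<and> graph_iso f (delete_point M v) N \<and>
        B = induced N (f ` nbrs M v))"
| "digital_disk 0 D \<longleftrightarrow> one_point D"
| "digital_disk (Suc 0) D \<longleftrightarrow>
     (\<exists>S v. digital_sphere (Suc 0) S \<and> v \<in> verts S \<and> isomorphic (delete_point S v) D)"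
| "digital_disk (Suc (Suc n)) D \<longleftrightarrow>
     (\<exists>B. bounded_manifold (Suc (Suc n)) D B) \<and> contractible_graph D"
  by pat_completeness auto

termination
  by (relation "measures
       [\<lambda>x. case x of
          Inl (Inl (n, _)) \<Rightarrow> n
        | Inl (Inr (n, _)) \<Rightarrow> n
        | Inr (Inl (n, _, _)) \<Rightarrow> n
        | Inr (Inr (n, _)) \<Rightarrow> n,
        \<lambda>x. case x of
          Inl (Inl (n, _)) \<Rightarrow> (if n \<le> 1 then 0 else 3)
        | Inl (Inr _) \<Rightarrow> 0
        | Inr (Inl _) \<Rightarrow> 1
        | Inr (Inr _) \<Rightarrow> 2]") auto

end

theory Submission
  imports Defs
begin

text \<open>
  Grow a set \<open>W\<close> of points that is contractible and whose complement \<open>C\<close> is connected, starting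
  from one point. If \<open>C\<close> has at least two points, some boundary point \<open>x\<close> of \<open>C\<close> is not a cut
  point of \<open>C\<close>. The rim of \<open>x\<close> meets \<open>W\<close> in a connected set: otherwise a shortest path in \<open>W\<close>
  between two parts of this intersection closes up through \<open>x\<close> to an induced one-sphere, and the disk
  that it bounds separates two points of \<open>C - {x}\<close> next to \<open>x\<close>. So the rim of \<open>x\<close> meets \<open>W\<close>
  in a proper arc, and \<open>W \<union> {x}\<close> is again contractible. Hence the complement of some point \<open>c\<close>
  is contractible, and gluing it to the cone over the rim of \<open>c\<close> gives the whole space. Of the
  disks in the hypothesis, only this separation property is used.
\<close>

subsection \<open>Connected sets and induced cycles of a relation\<close>

text \<open>Connectedness by closed subsets instead of paths, so that proofs and uses of it become
  closure arguments. For a symmetric \<open>E\<close> it is ordinary connectedness of a nonempty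
  set.\<close>

definition conn_set :: "('a \<Rightarrow> 'a \<Rightarrow> bool) \<Rightarrow> 'a set \<Rightarrow> bool" where
  "conn_set E A \<longleftrightarrow>
     A \<noteq> {} \<and> (\<forall>X\<subseteq>A. X \<noteq> {} \<longrightarrow> (\<forall>u\<in>X. \<forall>v\<in>A. E u v \<longrightarrow> v \<in> X) \<longrightarrow> X = A)"

text \<open>The one-spheres, read off from their point sets. Non-adjacency of the two neighbours
  rules out triangles: for a symmetric irreflexive \<open>E\<close> these are the sets that induce a
  cycle of length at least four.\<close>

definition induced_cycle :: "('a \<Rightarrow> 'a \<Rightarrow> bool) \<Rightarrow> 'a set \<Rightarrow> bool" where
  "induced_cycle E K \<longleftrightarrow> finite K \<and> conn_set E K \<and>
     (\<forall>v\<in>K. \<exists>a b. a \<noteq> b \<and> \<not> E a b \<and> {u \<in> K. E v u} = {a, b})"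

lemma conn_setI:
  assumes "A \<noteq> {}"
    and "\<And>X. X \<subseteq> A \<Longrightarrow> X \<noteq> {} \<Longrightarrow> (\<And>u v. u \<in> X \<Longrightarrow> v \<in> A \<Longrightarrow> E u v \<Longrightarrow> v \<in> X) \<Longrightarrow> A \<subseteq> X"
  shows "conn_set E A"
  unfolding conn_set_def using assms by (metis subset_antisym)

lemma conn_set_edge:
  assumes "conn_set E A" "X \<subseteq> A" "X \<noteq> {}" "X \<noteq> A"
  obtains u v where "u \<in> X" "v \<in> A - X" "E u v"
  using assms unfolding conn_set_def by (metis DiffI)

lemma conn_set_subset:
  assumes "conn_set E A" "X \<subseteq> A" "X \<noteq> {}" "\<And>u v. u \<in> X \<Longrightarrow> v \<in> A \<Longrightarrow> E u v \<Longrightarrow> v \<in> X"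
  shows "X = A"
  using assms unfolding conn_set_def by blast

lemma conn_set_singleton: "conn_set E {a}"
  by (rule conn_setI) auto

lemma conn_set_insert:
  assumes "conn_set E A" "symp E" "a \<in> A" "E a x"
  shows "conn_set E (insert x A)"
proof (rule conn_setI)
  fix X assume X: "X \<subseteq> insert x A" "X \<noteq> {}"
    and cl: "\<And>u v. u \<in> X \<Longrightarrow> v \<in> insert x A \<Longrightarrow> E u v \<Longrightarrow> v \<in> X"
  have "E x a" using assms by (meson sympD)
  then have "X \<inter> A \<noteq> {}" using X cl[of x a] assms(3) by auto
  then have "X \<inter> A = A"
    using conn_set_subset[OF assms(1), of "X \<inter> A"] cl by blast
  moreover have "x \<in> X" using cl[of a x] assms calculation by blast
  ultimately show "insert x A \<subseteq> X" by blast
qed simp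

lemma conn_set_image:
  assumes "conn_set E A" and "\<And>u v. u \<in> A \<Longrightarrow> v \<in> A \<Longrightarrow> E u v \<Longrightarrow> E' (f u) (f v)"
  shows "conn_set E' (f ` A)"
proof (rule conn_setI)
  show "f ` A \<noteq> {}" using assms(1) by (auto simp: conn_set_def)
next
  fix X assume X: "X \<subseteq> f ` A" "X \<noteq> {}"
    and cl: "\<And>u v. u \<in> X \<Longrightarrow> v \<in> f ` A \<Longrightarrow> E' u v \<Longrightarrow> v \<in> X"
  have "{u \<in> A. f u \<in> X} = A"
    by (rule conn_set_subset[OF assms(1)]) (use X cl assms(2) in blast)+
  then show "f ` A \<subseteq> X" by blast
qed

text \<open>Parity of a degree sum, proved by peeling: once \<open>p\<close> is removed, its only
  neighbour \<open>q\<close> becomes the one point of degree one and all others keep degree two. On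
  a finite set this descent cannot go on forever.\<close>

lemma no_single_odd_vertex:
  assumes "finite X" "symp E" "\<And>u. \<not> E u u" "p \<in> X" "card {u \<in> X. E p u} = 1"
    and "\<And>y. y \<in> X \<Longrightarrow> y \<noteq> p \<Longrightarrow> card {u \<in> X. E y u} = 2"
  shows False
  using assms(1,4-)
proof (induction "card X" arbitrary: X p rule: less_induct)
  case less
  obtain q where q: "{u \<in> X. E p u} = {q}" using less.prems(3) card_1_singletonE by blast
  have qX: "q \<in> X" "q \<noteq> p" "E q p" using q assms(2,3) by (auto dest: sympD)
  show False
  proof (rule less.hyps[of "X - {p}" q])
    show "card (X - {p}) < card X" using less.prems by (meson card_Diff1_less)
    have "{u \<in> X - {p}. E q u} = {u \<in> X. E q u} - {p}" by auto
    then show "card {u \<in> X - {p}. E q u} = 1"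
      using less.prems(1) less.prems(4)[OF qX(1,2)] qX less.prems(2) by simp
  next
    fix y assume y: "y \<in> X - {p}" "y \<noteq> q"
    then have "\<not> E y p" using q assms(2) by (auto dest: sympD)
    then have "{u \<in> X - {p}. E y u} = {u \<in> X. E y u}" by auto
    then show "card {u \<in> X - {p}. E y u} = 2" using less.prems(4) y by simp
  qed (use less.prems qX in auto)
qed

lemma induced_cycle_nbrs:
  assumes "induced_cycle E K" "v \<in> K"
  obtains a b where "a \<noteq> b" "\<not> E a b" "{u \<in> K. E v u} = {a, b}"
proof -
  have "\<exists>a b. a \<noteq> b \<and> \<not> E a b \<and> {u \<in> K. E v u} = {a, b}"
    using assms unfolding induced_cycle_def by (elim conjE) (rule bspec)
  then show ?thesis by (elim exE conjE) (rule that)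
qed

text \<open>Suppose the rest falls apart into \<open>X\<close> and \<open>Y\<close>. Each of them
  must reach \<open>v\<close>, so each holds exactly one of the two neighbours of \<open>v\<close>.
  Then \<open>X\<close> has a single point of odd degree, against
  \<open>no_single_odd_vertex\<close>.\<close>

lemma induced_cycle_minus_point:
  assumes K: "induced_cycle E K" "symp E" "\<And>u. \<not> E u u" "v \<in> K"
  shows "conn_set E (K - {v})"
proof (rule conn_setI)
  obtain a b where ab: "a \<noteq> b" "{u \<in> K. E v u} = {a, b}"
    using induced_cycle_nbrs[OF K(1,4)] by metis
  have conn: "conn_set E K" and fin: "finite K" using K(1) by (auto simp: induced_cycle_def)
  have "a \<noteq> v" using ab K(3) by auto
  then show "K - {v} \<noteq> {}" using ab by auto
  fix X assume X: "X \<subseteq> K - {v}" "X \<noteq> {}"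
    and cl: "\<And>x y. x \<in> X \<Longrightarrow> y \<in> K - {v} \<Longrightarrow> E x y \<Longrightarrow> y \<in> X"
  show "K - {v} \<subseteq> X"
  proof (rule ccontr)
    assume "\<not> K - {v} \<subseteq> X"
    define Y where "Y = K - {v} - X"
    have Y: "Y \<subseteq> K" "Y \<noteq> {}" "Y \<noteq> K" using \<open>\<not> K - {v} \<subseteq> X\<close> K(4) by (auto simp: Y_def)
    obtain x x' where x: "x \<in> X" "x' \<in> K - X" "E x x'"
      using conn_set_edge[OF conn, of X] X K(4) by auto
    then have xv: "E x v" using cl by (metis Diff_iff singletonD)
    obtain y y' where y: "y \<in> Y" "y' \<in> K - Y" "E y y'"
      using conn_set_edge[OF conn Y] by metis
    then have yv: "E y v" using cl[of y' y] K(2) by (auto simp: Y_def dest: sympD)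
    have "x \<noteq> y" "x \<in> K" "y \<in> K" using x y X by (auto simp: Y_def)
    moreover have "E v x" "E v y" using xv yv K(2) by (meson sympD)+
    ultimately have "{x, y} \<subseteq> {a, b}" using ab(2) by blast
    then have nv: "{u \<in> K. E v u} = {x, y}" using ab(2) \<open>x \<noteq> y\<close> by blast
    have deg: "card {u \<in> K. E z u} = 2" if "z \<in> K" for z
      using induced_cycle_nbrs[OF K(1) that] by (metis card_2_iff)
    have Xnbrs: "{u \<in> X. E z u} = {u \<in> K. E z u} - {v}" if "z \<in> X" for z
      using cl[OF that] X by auto
    show False
    proof (rule no_single_odd_vertex[of X E x])
      show "finite X" using X fin finite_subset by blast
      show "card {u \<in> X. E x u} = 1"
        using Xnbrs[OF x(1)] deg[OF \<open>x \<in> K\<close>] xv K(4) fin by simp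
    next
      fix z assume z: "z \<in> X" "z \<noteq> x"
      then have "z \<noteq> y" "z \<in> K" using y X by (auto simp: Y_def)
      then have "\<not> E z v" using nv z K(2) by (auto dest: sympD)
      then show "card {u \<in> X. E z u} = 2" using Xnbrs[OF z(1)] deg[OF \<open>z \<in> K\<close>] by simp
    qed (use K x in auto)
  qed
qed

text \<open>A walk of least length from \<open>A\<close> to \<open>B\<close> has all the listed
  properties: a chord, a repeated point or an inner point in \<open>A\<close> or \<open>B\<close>
  would allow a shorter walk.\<close>

lemma shortest_path:
  fixes E :: "'a \<Rightarrow> 'a \<Rightarrow> bool"
  assumes "\<And>u. \<not> E u u" "conn_set E W" "A \<subseteq> W" "B \<subseteq> W" "A \<noteq> {}" "B \<noteq> {}"
    "A \<inter> B = {}"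
  obtains p n where "p 0 \<in> A" "p n \<in> B" "\<And>i. i \<le> n \<Longrightarrow> p i \<in> W"
    "\<And>i. i < n \<Longrightarrow> E (p i) (p (Suc i))"
    "\<And>i. 0 < i \<Longrightarrow> i < n \<Longrightarrow> p i \<notin> A \<union> B"
    "\<And>i j. i < j \<Longrightarrow> j \<le> n \<Longrightarrow> E (p i) (p j) \<Longrightarrow> j = Suc i"
    "\<And>i j. i < j \<Longrightarrow> j \<le> n \<Longrightarrow> p i \<noteq> p j"
proof -
  define walk where "walk p n \<longleftrightarrow> p 0 \<in> A \<and> (\<forall>i\<le>n. p i \<in> W) \<and> (\<forall>i<n. E (p i) (p (Suc i)))"
    for p :: "nat \<Rightarrow> 'a" and n
  \<comment> \<open>The ends of walks starting in \<open>A\<close> form a closed subset of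
    \<open>W\<close>, hence all of \<open>W\<close>; in particular \<open>B\<close> is
    reached.\<close>
  have "{y \<in> W. \<exists>p n. walk p n \<and> p n = y} = W" (is "?R = W")
  proof (rule conn_set_subset[OF assms(2)])
    obtain a where "a \<in> A" using assms(5) by auto
    then have "walk (\<lambda>_. a) 0" using assms(3) by (auto simp: walk_def)
    then show "?R \<noteq> {}" using \<open>a \<in> A\<close> assms(3) by auto
  next
    fix u v assume u: "u \<in> ?R" "v \<in> W" "E u v"
    then obtain p n where "walk p n" "p n = u" by auto
    then have "walk (p(Suc n := v)) (Suc n)" using u by (auto simp: walk_def less_Suc_eq le_Suc_eq)
    then show "v \<in> ?R" using u by (metis (mono_tags, lifting) fun_upd_same mem_Collect_eq)
  qed auto
  moreover obtain b where "b \<in> B" "b \<in> W" using assms(4,6) by blast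
  ultimately have "\<exists>n p. walk p n \<and> p n \<in> B" by (smt (verit) mem_Collect_eq)
  define n where "n = (LEAST n. \<exists>p. walk p n \<and> p n \<in> B)"
  obtain p where p: "walk p n" "p n \<in> B"
    using LeastI_ex[OF \<open>\<exists>n p. walk p n \<and> p n \<in> B\<close>] by (auto simp: n_def)
  have least: "n \<le> m" if "walk q m" "q m \<in> B" for q m
    unfolding n_def using that by (blast intro: Least_le)
  have inner: "p i \<notin> A \<union> B" if i: "0 < i" "i < n" for i
  proof -
    have "p i \<notin> B" using least[of p i] p i by (auto simp: walk_def)
    moreover have "p i \<notin> A" using least[of "\<lambda>k. p (k + i)" "n - i"] p i by (auto simp: walk_def)
    ultimately show ?thesis by blast
  qed
  have chord: "j = Suc i" if ij: "i < j" "j \<le> n" "E (p i) (p j)" for i j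
  proof -
    \<comment> \<open>\<open>q\<close> follows \<open>p\<close> up to \<open>i\<close>, jumps along
      the chord to \<open>p j\<close> and goes on from there. The shift \<open>j - Suc i\<close>
      counts the points left out, so \<open>n \<le> m\<close> forces
      \<open>j \<le> Suc i\<close>.\<close>
    define q where "q k = (if k \<le> i then p k else p (k + j - Suc i))" for k
    define m where "m = n + Suc i - j"
    have "E (q k) (q (Suc k))" if "k < m" for k
    proof -
      consider "k < i" | "k = i" | "k > i" by linarith
      then show ?thesis
      proof cases
        case 3
        then have "Suc k + j - Suc i = Suc (k + j - Suc i)" "k + j - Suc i < n"
          using that ij by (auto simp: m_def)
        then show ?thesis using 3 p by (auto simp: q_def walk_def)
      qed (use p ij in \<open>auto simp: q_def walk_def\<close>)
    qed
    moreover have "q k \<in> W" if "k \<le> m" for k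
      using that p ij by (auto simp: q_def walk_def m_def)
    ultimately have "walk q m" using p by (auto simp: walk_def q_def)
    moreover have "q m = p n" using ij by (auto simp: q_def m_def)
    ultimately have "n \<le> m" using least p by simp
    then show "j = Suc i" using ij by (simp add: m_def)
  qed
  have "p i \<noteq> p j" if "i < j" "j \<le> n" for i j
  proof
    assume eq: "p i = p j"
    \<comment> \<open>If \<open>j = n\<close>, then \<open>p i\<close> lies in \<open>B\<close> too
      early. If \<open>j < n\<close>, the step from \<open>p j\<close> to \<open>p (Suc j)\<close>
      is also a chord starting at \<open>p i\<close> that spans more than one step.\<close>
    show False
    proof (cases "j = n")
      case True
      then show False using p inner[of i] that eq assms(7) by (cases "i = 0") (auto simp: walk_def)
    next
      case False
      then have "E (p i) (p (Suc j))" using p that eq by (auto simp: walk_def)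
      then show False using chord[of i "Suc j"] that False by simp
    qed
  qed
  then show ?thesis using that[of p n] p inner chord by (simp add: walk_def)
qed

subsection \<open>Closed surfaces in which every induced cycle separates\<close>

locale surface =
  fixes E :: "'a \<Rightarrow> 'a \<Rightarrow> bool" and V :: "'a set"
  assumes fin: "finite V" and conn: "conn_set E V"
    and sym: "symp E" and irrefl: "\<not> E u u" and ends: "E u v \<Longrightarrow> v \<in> V"
    and link: "v \<in> V \<Longrightarrow> induced_cycle E {u. E v u}"
begin

lemma E_sym: "E u v \<Longrightarrow> E v u"
  using sym by (meson sympD)

lemma link_conn: "v \<in> V \<Longrightarrow> conn_set E {u. E v u}"
  using link unfolding induced_cycle_def by blast

text \<open>A closed surface has no cut point because links are connected: the link of
  \<open>x\<close> meets \<open>L\<close>, cannot leave it, and so lies in \<open>L\<close>. Thus no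
  edge leads out of \<open>insert x L\<close>.\<close>

lemma no_cut_vertex:
  assumes "L \<subseteq> V" "L \<noteq> {}" "x \<in> V" "x \<notin> L" "\<And>u v. u \<in> L \<Longrightarrow> E u v \<Longrightarrow> v \<in> insert x L"
  shows "V = insert x L"
proof (rule ccontr)
  assume ne: "V \<noteq> insert x L"
  obtain l v where l: "l \<in> L" "v \<in> V - L" "E l v"
    using conn_set_edge[OF conn assms(1,2)] assms(3,4) by blast
  then have "E x l" using assms(5) E_sym by blast
  obtain u y where y: "u \<in> insert x L" "y \<in> V - insert x L" "E u y"
    using conn_set_edge[OF conn, of "insert x L"] assms ne by blast
  then have "E x y" using assms(5) by blast
  have "{u. E x u} \<inter> L = {u. E x u}"
    by (rule conn_set_subset[OF link_conn[OF assms(3)]])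
      (use assms(5) \<open>E x l\<close> l irrefl in blast)+
  then show False using \<open>E x y\<close> y by blast
qed

lemma conn_minus_point:
  assumes "x \<in> V"
  shows "conn_set E (V - {x})"
proof (rule conn_setI)
  obtain a where "E x a" using link_conn[OF assms] by (auto simp: conn_set_def)
  then show "V - {x} \<noteq> {}" using ends irrefl by blast
  fix X assume "X \<subseteq> V - {x}" "X \<noteq> {}"
    and "\<And>u v. u \<in> X \<Longrightarrow> v \<in> V - {x} \<Longrightarrow> E u v \<Longrightarrow> v \<in> X"
  then show "V - {x} \<subseteq> X" using no_cut_vertex[of X x] ends assms by blast
qed

text \<open>An extremal argument: among the boundary points \<open>x\<close> of \<open>C\<close>,
  each paired with a connected \<open>K \<subseteq> C - {x}\<close>, a pair with the largest
  \<open>K\<close> already has \<open>K = C - {x}\<close>.\<close>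

lemma boundary_non_cut_vertex:
  assumes C: "conn_set E C" "C \<subseteq> V" "C \<noteq> V" "card C \<ge> 2"
  obtains x y where "x \<in> C" "y \<in> V - C" "E x y" "conn_set E (C - {x})"
proof -
  define good where "good z \<longleftrightarrow> fst z \<in> C \<and> (\<exists>y\<in>V - C. E (fst z) y)
      \<and> snd z \<subseteq> C - {fst z} \<and> conn_set E (snd z)" for z
  have finC: "finite C" using C(2) fin finite_subset by blast
  have bound: "\<forall>z. good z \<longrightarrow> card (snd z) < Suc (card C)"
    using finC by (auto simp: good_def less_Suc_eq_le intro!: card_mono)
  obtain x0 y0 where x0: "x0 \<in> C" "y0 \<in> V - C" "E x0 y0"
    using conn_set_edge[OF conn C(2) _ C(3)] C(1) by (auto simp: conn_set_def)
  have "C \<noteq> {x0}" using C(4) by auto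
  then obtain k where "k \<in> C - {x0}" using x0 by blast
  then have "good (x0, {k})" using x0 conn_set_singleton by (auto simp: good_def)
  then obtain z where z: "good z" and max: "\<And>z'. good z' \<Longrightarrow> card (snd z') \<le> card (snd z)"
    using ex_has_greatest_nat[of good _ "\<lambda>z. card (snd z)", OF _ bound] by blast
  obtain x K where zxK: "z = (x, K)" by fastforce
  obtain y where x: "x \<in> C" "y \<in> V - C" "E x y" and K: "K \<subseteq> C - {x}" "conn_set E K"
    using z zxK by (auto simp: good_def)
  have "finite K" using K(1) finC finite_subset by blast
  have closed: "v \<in> insert x K" if "u \<in> K" "v \<in> C" "E u v" for u v
  proof (rule ccontr)
    assume v: "v \<notin> insert x K"
    have "good (x, insert v K)"
      using conn_set_insert[OF K(2) sym that(1,3)] x K v that by (auto simp: good_def)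
    then show False using max[of "(x, insert v K)"] v \<open>finite K\<close> by (simp add: zxK)
  qed
  have "K = C - {x}"
  proof (rule ccontr)
    assume neq: "K \<noteq> C - {x}"
    \<comment> \<open>Since \<open>x\<close> is not a cut point of the whole surface, the leftover
      \<open>L\<close> has an edge to some \<open>w\<close> outside \<open>insert x L\<close>. As
      \<open>K\<close> has no edge to \<open>L\<close>, this \<open>w\<close> is outside
      \<open>C\<close>, and the end \<open>l\<close> of the edge is itself a boundary point.\<close>
    define L where "L = C - {x} - K"
    have "L \<noteq> {}" "L \<subseteq> V" "x \<notin> L" "x \<in> V" using neq K(1) C(2) x by (auto simp: L_def)
    moreover have "V \<noteq> insert x L" using x by (auto simp: L_def)
    ultimately obtain l w where l: "l \<in> L" "E l w" "w \<notin> insert x L"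
      using no_cut_vertex[of L x] by metis
    have "w \<notin> C" using l closed[of w l] E_sym by (auto simp: L_def)
    then have w: "w \<in> V - C" using ends l by blast
    have "K \<noteq> {}" using K(2) by (simp add: conn_set_def)
    then obtain k k' where "k \<in> K" "k' \<in> C - K" "E k k'"
      using conn_set_edge[OF C(1), of K] K(1) x by blast
    then have "E k x" using closed by blast
    \<comment> \<open>Taking \<open>l\<close> in place of \<open>x\<close> frees \<open>x\<close> to
      join the connected set, against the maximality of \<open>K\<close>.\<close>
    have "good (l, insert x K)"
      using conn_set_insert[OF K(2) sym \<open>k \<in> K\<close> \<open>E k x\<close>] l w K x by (auto simp: good_def L_def)
    moreover have "x \<notin> K" using K by blast
    ultimately show False using max[of "(l, insert x K)"] \<open>finite K\<close> by (simp add: zxK)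
  qed
  then show ?thesis using that x K by blast
qed

text \<open>
  What the separation argument needs to know about a disk \<open>D\<close> with boundary \<open>S\<close>: interior points have
  their whole rim in \<open>D\<close>, and the rim of a boundary point meets \<open>D\<close> in an arc with end points in \<open>S\<close>.
\<close>

definition fills :: "'a set \<Rightarrow> 'a set \<Rightarrow> bool" where
  "fills D S \<longleftrightarrow> S \<subseteq> D \<and> D \<subseteq> V \<and>
     (\<forall>y\<in>D - S. \<forall>u. E y u \<longrightarrow> u \<in> D) \<and>
     (\<forall>x\<in>S. conn_set E ({u. E x u} \<inter> D)) \<and>
     (\<forall>x\<in>S. \<forall>a\<in>S. E x a \<longrightarrow> (\<forall>p\<in>D. \<forall>q\<in>D. E x p \<and> E a p \<and> E x q \<and> E a q \<longrightarrow> p = q))"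

text \<open>A chordless path closes up through a point \<open>x\<close> next to its two ends only.
  The bound \<open>n \<ge> 2\<close> keeps the ends, which are the two neighbours of
  \<open>x\<close>, non-adjacent.\<close>

lemma induced_cycle_cone_over_path:
  assumes "n \<ge> 2" and xp: "\<And>j. j \<le> n \<Longrightarrow> x \<noteq> p j" and x: "E x (p 0)" "E x (p n)"
    "\<And>i. 0 < i \<Longrightarrow> i < n \<Longrightarrow> \<not> E x (p i)"
    and p: "\<And>i. i < n \<Longrightarrow> E (p i) (p (Suc i))"
    and chord: "\<And>i j. i < j \<Longrightarrow> j \<le> n \<Longrightarrow> E (p i) (p j) \<Longrightarrow> j = Suc i"
    and inj: "\<And>i j. i < j \<Longrightarrow> j \<le> n \<Longrightarrow> p i \<noteq> p j"
  shows "induced_cycle E (insert x (p ` {..n}))" (is "induced_cycle E ?S")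
proof -
  have adj: "E (p i) (p j) \<longleftrightarrow> j = Suc i \<or> i = Suc j" if "i \<le> n" "j \<le> n" for i j
  proof
    assume e: "E (p i) (p j)"
    then have "i \<noteq> j" using irrefl by metis
    then consider "i < j" | "j < i" by linarith
    then show "j = Suc i \<or> i = Suc j"
      using chord[OF _ that(2) e] chord[OF _ that(1) E_sym[OF e]] by cases blast+
  next
    assume "j = Suc i \<or> i = Suc j"
    then show "E (p i) (p j)"
    proof
      assume "j = Suc i"
      then show ?thesis using p[of i] that by simp
    next
      assume "i = Suc j"
      then show ?thesis using E_sym[OF p[of j]] that by simp
    qed
  qed
  have adjx: "E x (p i) \<longleftrightarrow> i = 0 \<or> i = n" if "i \<le> n" for i
  proof (cases "i = 0 \<or> i = n")
    case True
    then show ?thesis using x(1,2) by (elim disjE) simp_all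
  next
    case False
    then show ?thesis using x(3)[of i] that by simp
  qed
  have eqp: "p i = p j \<longleftrightarrow> i = j" if "i \<le> n" "j \<le> n" for i j
  proof (rule linorder_cases[of i j])
    show ?thesis if "i < j" using inj[OF that \<open>j \<le> n\<close>] that by simp
    show ?thesis if "j < i" using inj[OF that \<open>i \<le> n\<close>] that by simp
  qed simp
  have "conn_set E (p ` {..m})" if "m \<le> n" for m
    using that
  proof (induction m)
    case 0
    then show ?case by (simp add: conn_set_singleton)
  next
    case (Suc m)
    then have "conn_set E (insert (p (Suc m)) (p ` {..m}))"
      by (intro conn_set_insert[OF _ sym, of _ "p m"]) (auto intro: p)
    then show ?case by (simp add: atMost_Suc)
  qed
  then have "conn_set E ?S"
    using x(1) E_sym by (intro conn_set_insert[OF _ sym, of _ "p 0"]) auto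
  moreover have "\<exists>a b. a \<noteq> b \<and> \<not> E a b \<and> {u \<in> ?S. E v u} = {a, b}" if "v \<in> ?S" for v
  proof -
    from that consider "v = x" | i where "v = p i" "i \<le> n" by auto
    then show ?thesis
    proof cases
      case 1
      have "{u \<in> ?S. E v u} = {p 0, p n}" using 1 irrefl adjx by auto
      moreover have "\<not> E (p 0) (p n)" "p 0 \<noteq> p n" using adj eqp \<open>n \<ge> 2\<close> by auto
      ultimately show ?thesis by blast
    next
      case 2
      have vx: "E v x \<longleftrightarrow> i = 0 \<or> i = n" using adjx 2 E_sym by metis
      \<comment> \<open>Neighbours are computed on indices: an inner index has two of them, while
        \<open>0\<close> and \<open>n\<close> have one and gain \<open>x\<close>.\<close>
      have nb: "{u \<in> ?S. E v u} = p ` {j. j \<le> n \<and> (j = Suc i \<or> i = Suc j)} \<union> {u. u = x \<and> E v x}"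
        using 2 adj by auto
      consider "i = 0" | "i = n" "i > 0" | "0 < i" "i < n" using 2 by linarith
      then show ?thesis
      proof cases
        case 1
        then have "{j. j \<le> n \<and> (j = Suc i \<or> i = Suc j)} = {1}" using \<open>n \<ge> 2\<close> by auto
        then have "{u \<in> ?S. E v u} = {x, p 1}" using nb vx 1 by auto
        moreover have "\<not> E x (p 1)" "x \<noteq> p 1" using adjx[of 1] xp[of 1] \<open>n \<ge> 2\<close> by auto
        ultimately show ?thesis by blast
      next
        case 2
        then have "{j. j \<le> n \<and> (j = Suc i \<or> i = Suc j)} = {n - 1}" by auto
        then have "{u \<in> ?S. E v u} = {x, p (n - 1)}" using nb vx 2 by auto
        moreover have "\<not> E x (p (n - 1))" "x \<noteq> p (n - 1)"
          using adjx[of "n - 1"] xp[of "n - 1"] \<open>n \<ge> 2\<close> by auto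
        ultimately show ?thesis by blast
      next
        case 3
        then have "{j. j \<le> n \<and> (j = Suc i \<or> i = Suc j)} = {i - 1, Suc i}" by auto
        then have "{u \<in> ?S. E v u} = {p (i - 1), p (Suc i)}" using nb vx 3 by auto
        moreover have "\<not> E (p (i - 1)) (p (Suc i))" "p (i - 1) \<noteq> p (Suc i)"
          using adj[of "i - 1" "Suc i"] eqp[of "i - 1" "Suc i"] 3 by auto
        ultimately show ?thesis by blast
      qed
    qed
  qed
  ultimately show ?thesis by (auto simp: induced_cycle_def)
qed

text \<open>If the link of \<open>x\<close> outside \<open>C\<close> split into \<open>A\<close> and
  \<open>B\<close>, a shortest path between them through \<open>V - C\<close> would give a cycle
  \<open>S\<close> through \<open>x\<close>, filled by some \<open>D\<close>. The connected set
  \<open>C - {x}\<close> misses \<open>S\<close>, so it misses \<open>D\<close> or lies in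
  \<open>D\<close>. In the first case the part of the link in \<open>D\<close> is connected and
  joins \<open>A\<close> to \<open>B\<close> while avoiding \<open>C\<close>; in the second, the
  link points outside \<open>D\<close> are trapped in one of \<open>A\<close> and
  \<open>B\<close>.\<close>

lemma attaching_set_connected:
  assumes fill: "\<And>S. S \<subseteq> V \<Longrightarrow> induced_cycle E S \<Longrightarrow> \<exists>D. fills D S"
    and W: "conn_set E (V - C)" and C: "C \<subseteq> V" "x \<in> C" "conn_set E (C - {x})"
    and y: "E x y" "y \<notin> C"
  shows "conn_set E ({u. E x u} - C)"
proof (rule conn_setI)
  show "{u. E x u} - C \<noteq> {}" using y by blast
  fix A assume A: "A \<subseteq> {u. E x u} - C" "A \<noteq> {}"
    and cl: "\<And>u v. u \<in> A \<Longrightarrow> v \<in> {u. E x u} - C \<Longrightarrow> E u v \<Longrightarrow> v \<in> A"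
  show "{u. E x u} - C \<subseteq> A"
  proof (rule ccontr)
    assume nsub: "\<not> {u. E x u} - C \<subseteq> A"
    define B where "B = {u. E x u} - C - A"
    have B: "B \<subseteq> {u. E x u} - C" "B \<noteq> {}" "A \<inter> B = {}" using nsub by (auto simp: B_def)
    have nAB: "\<not> E u v" "\<not> E v u" if "u \<in> A" "v \<in> B" for u v
      using cl[of u v] that E_sym[of v u] by (auto simp: B_def)
    have AB: "u \<in> A \<or> u \<in> B" if "E x u" "u \<notin> C" for u using that by (auto simp: B_def)
    have AW: "A \<subseteq> V - C" "B \<subseteq> V - C" using A B ends by blast+
    obtain p n where p: "p 0 \<in> A" "p n \<in> B" "\<And>i. i \<le> n \<Longrightarrow> p i \<in> V - C"
      "\<And>i. i < n \<Longrightarrow> E (p i) (p (Suc i))"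
      "\<And>i. 0 < i \<Longrightarrow> i < n \<Longrightarrow> p i \<notin> A \<union> B"
      "\<And>i j. i < j \<Longrightarrow> j \<le> n \<Longrightarrow> E (p i) (p j) \<Longrightarrow> j = Suc i"
      "\<And>i j. i < j \<Longrightarrow> j \<le> n \<Longrightarrow> p i \<noteq> p j"
      by (rule shortest_path[OF irrefl W AW A(2) B(2,3)]) (rule that)
    have "n \<noteq> 0" using p(1,2) B(3) by (metis disjoint_iff)
    moreover have "n \<noteq> 1" using p(1,2) p(4)[of 0] nAB by auto
    ultimately have n: "n \<ge> 2" by linarith
    have xp: "E x (p 0)" "E x (p n)" using p(1,2) A B by auto
    have nxp: "\<not> E x (p i)" if "0 < i" "i < n" for i
      using p(5)[OF that] p(3)[of i] that AB by auto
    define S where "S = insert x (p ` {..n})"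
    have "x \<noteq> p j" if "j \<le> n" for j using p(3)[OF that] C(2) \<open>x \<in> C\<close> by auto
    then have "induced_cycle E S"
      unfolding S_def using induced_cycle_cone_over_path[OF n _ xp nxp p(4,6,7)] by blast
    moreover have "S \<subseteq> V" using p(3) C by (auto simp: S_def)
    ultimately obtain D where "fills D S" using fill by blast
    have "x \<in> S" by (simp add: S_def)
    with \<open>fills D S\<close> have D: "S \<subseteq> D" and inner: "\<And>y u. y \<in> D - S \<Longrightarrow> E y u \<Longrightarrow> u \<in> D"
      and conn_D: "conn_set E ({u. E x u} \<inter> D)"
      and single: "\<And>a p q. a \<in> S \<Longrightarrow> E x a \<Longrightarrow> p \<in> D \<Longrightarrow> q \<in> D \<Longrightarrow> E x p \<Longrightarrow> E a p
        \<Longrightarrow> E x q \<Longrightarrow> E a q \<Longrightarrow> p = q"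
      unfolding fills_def by blast+
    have CS: "(C - {x}) \<inter> S = {}" using p(3) by (auto simp: S_def)
    have Sx: "u = p 0 \<or> u = p n" if u: "u \<in> S" "E x u" for u
    proof -
      have "u \<noteq> x" using u irrefl by metis
      then obtain i where i: "u = p i" "i \<le> n" using u(1) by (auto simp: S_def)
      then have "\<not> (0 < i \<and> i < n)" using nxp u(2) by blast
      then have "i = 0 \<or> i = n" using i(2) by linarith
      then show ?thesis using i(1) by blast
    qed
    have "x \<in> V" using C by blast
    note cyc = link[OF this]
    show False
    proof (cases "(C - {x}) \<inter> D = {}")
      case True
      have "A \<inter> D = {u. E x u} \<inter> D"
      proof (rule conn_set_subset[OF conn_D])
        show "A \<inter> D \<noteq> {}" using p(1) D by (auto simp: S_def)
        fix u v assume "u \<in> A \<inter> D" "v \<in> {u. E x u} \<inter> D" "E u v"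
        moreover from this have "v \<notin> C" using True irrefl by blast
        ultimately show "v \<in> A \<inter> D" using cl by blast
      qed (use A in blast)
      moreover have "p n \<in> {u. E x u} \<inter> D" using xp D by (auto simp: S_def)
      ultimately show False using p(2) B(3) by blast
    next
      case False
      \<comment> \<open>Neighbours of points of \<open>D - S\<close> stay in \<open>D\<close>, so a
        connected set that misses \<open>S\<close> and meets \<open>D\<close> lies in
        \<open>D\<close>.\<close>
      have "(C - {x}) \<inter> D = C - {x}"
        by (rule conn_set_subset[OF C(3)]) (use False inner CS in blast)+
      then have CD: "C - {x} \<subseteq> D" by blast
      text \<open>The neighbours of \<open>x\<close> outside \<open>D\<close> in one of the two parts are joined to the rest of the
        link of \<open>x\<close> only through the one point of \<open>S\<close> in that part.\<close>
      have key: False if "q \<in> A'" "q \<notin> D" and "a \<in> A'" "b \<in> B'" and disj: "A' \<inter> B' = {}"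
        and sep: "\<And>u v. u \<in> A' \<Longrightarrow> v \<in> B' \<Longrightarrow> \<not> E u v"
        and un: "A' \<union> B' = A \<union> B" and ab: "{a, b} = {p 0, p n}" for A' B' a b q
      proof -
        have sub: "A' \<subseteq> {u. E x u}" "B' \<subseteq> {u. E x u}" using un A B by blast+
        have "E x a" "E x b" using ab xp by (metis doubleton_eq_iff)+
        have "a \<in> D" "b \<in> D" using ab D by (auto simp: S_def doubleton_eq_iff)
        have "A' - D = {u. E x u} - {a}"
        proof (rule conn_set_subset[OF induced_cycle_minus_point[OF cyc sym irrefl]])
          show "A' - D \<subseteq> {u. E x u} - {a}" using sub \<open>a \<in> D\<close> by blast
          show "A' - D \<noteq> {}" using that by blast
          fix u v assume u: "u \<in> A' - D" "v \<in> {u. E x u} - {a}" "E u v"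
          have "v \<notin> D - S" using inner u E_sym by blast
          moreover have "v \<notin> B'" using sep u by blast
          ultimately have "v \<notin> D" using Sx u \<open>b \<in> B'\<close> ab by blast
          moreover have "v \<notin> C" using CD \<open>v \<notin> D\<close> u irrefl by blast
          ultimately show "v \<in> A' - D" using AB[of v] un u \<open>v \<notin> B'\<close> by blast
        qed (use \<open>E x a\<close> in simp)
        moreover have "b \<noteq> a" using that disj by blast
        ultimately show False using \<open>E x b\<close> \<open>b \<in> D\<close> by blast
      qed
      \<comment> \<open>The edge from \<open>x\<close> to \<open>p 0\<close> has two common
        neighbours in the surface, of which \<open>D\<close> holds at most one. So the link of
        \<open>x\<close> has a point \<open>q\<close> outside \<open>D\<close>.\<close>
      obtain c d where cd: "c \<noteq> d" "{u \<in> {u. E x u}. E (p 0) u} = {c, d}"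
        using induced_cycle_nbrs[OF cyc] xp by (metis mem_Collect_eq)
      have "p 0 \<in> S" by (auto simp: S_def)
      then have "c \<notin> D \<or> d \<notin> D" using single[OF _ xp(1), of c d] cd by blast
      then obtain q where q: "q \<notin> D" "E x q" using cd by blast
      then have "q \<notin> C" using CD irrefl by blast
      then consider "q \<in> A" | "q \<in> B" using AB q by blast
      then show False
      proof cases
        case 1
        show False by (rule key[OF 1 q(1) p(1,2) B(3)]) (use nAB in auto)
      next
        case 2
        show False by (rule key[OF 2 q(1) p(2,1)]) (use nAB B(3) in auto)
      qed
    qed
  qed
qed

end

subsection \<open>Induced subgraphs\<close>

lemma adjacent_sym: "adjacent G u v \<Longrightarrow> adjacent G v u"
  by (simp add: adjacent_def insert_commute)

lemma digital_space_adjacent: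
  assumes "digital_space G" "adjacent G u v"
  shows "u \<in> verts G" "v \<in> verts G" "u \<noteq> v"
  using assms unfolding digital_space_def adjacent_def by fastforce+

lemma digital_space_edge:
  assumes "digital_space G" "e \<in> edges G"
  obtains u v where "e = {u, v}" "adjacent G u v"
  using assms unfolding digital_space_def adjacent_def by (metis card_2_iff)

lemma adjacent_induced [simp]:
  "adjacent (induced G A) u v \<longleftrightarrow> adjacent G u v \<and> u \<in> A \<and> v \<in> A"
  by (auto simp: adjacent_def induced_def)

lemma verts_induced [simp]: "verts (induced G A) = verts G \<inter> A"
  by (simp add: induced_def)

lemma induced_induced [simp]: "induced (induced G A) B = induced G (A \<inter> B)"
  by (auto simp: induced_def)

lemma nbrs_eq: "digital_space G \<Longrightarrow> nbrs G v = {u. adjacent G v u}"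
  by (auto simp: nbrs_def dest: digital_space_adjacent)

lemma nbrs_induced: "v \<in> A \<Longrightarrow> nbrs (induced G A) v = nbrs G v \<inter> A"
  by (auto simp: nbrs_def)

lemma digital_space_induced: "digital_space G \<Longrightarrow> digital_space (induced G A)"
  by (auto simp: digital_space_def induced_def)

lemma conn_set_cong:
  assumes "\<And>u v. u \<in> A \<Longrightarrow> v \<in> A \<Longrightarrow> E u v \<longleftrightarrow> E' u v"
  shows "conn_set E A \<longleftrightarrow> conn_set E' A"
proof -
  have "(\<forall>u\<in>X. \<forall>v\<in>A. E u v \<longrightarrow> v \<in> X) \<longleftrightarrow> (\<forall>u\<in>X. \<forall>v\<in>A. E' u v \<longrightarrow> v \<in> X)"
    if "X \<subseteq> A" for X
    using assms that by blast
  then show ?thesis unfolding conn_set_def by (metis (no_types, lifting))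
qed

lemma connected_graph_conn_set:
  assumes "digital_space G"
  shows "connected_graph G \<longleftrightarrow> conn_set (adjacent G) (verts G)"
proof
  assume G: "connected_graph G"
  show "conn_set (adjacent G) (verts G)"
  proof (rule conn_setI)
    show "verts G \<noteq> {}" using G by (simp add: connected_graph_def)
    fix X assume X: "X \<subseteq> verts G" "X \<noteq> {}"
      and cl: "\<And>u v. u \<in> X \<Longrightarrow> v \<in> verts G \<Longrightarrow> adjacent G u v \<Longrightarrow> v \<in> X"
    obtain u where "u \<in> X" using X by blast
    have "v \<in> X" if "(adjacent G)\<^sup>*\<^sup>* u v" for v
      using that
    proof induction
      case (step y z)
      then show ?case using cl digital_space_adjacent(2)[OF assms] by blast
    qed fact
    then show "verts G \<subseteq> X" using G X \<open>u \<in> X\<close> unfolding connected_graph_def by blast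
  qed
next
  assume G: "conn_set (adjacent G) (verts G)"
  have "(adjacent G)\<^sup>*\<^sup>* u v" if "u \<in> verts G" "v \<in> verts G" for u v
  proof -
    have "{w \<in> verts G. (adjacent G)\<^sup>*\<^sup>* u w} = verts G"
      by (rule conn_set_subset[OF G]) (use that in \<open>auto intro: rtranclp.rtrancl_into_rtrancl\<close>)
    then show ?thesis using that by blast
  qed
  moreover have "verts G \<noteq> {}" using G by (simp add: conn_set_def)
  ultimately show "connected_graph G" by (simp add: connected_graph_def)
qed

lemma connected_graph_induced:
  assumes "digital_space G" "A \<subseteq> verts G"
  shows "connected_graph (induced G A) \<longleftrightarrow> conn_set (adjacent G) A"
proof -
  have "verts G \<inter> A = A" using assms by blast
  then show ?thesis
    using connected_graph_conn_set[OF digital_space_induced[OF assms(1)], of A]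
      conn_set_cong[of A "adjacent (induced G A)" "adjacent G"] by simp
qed

lemma digital_sphere_0_induced:
  assumes "digital_space G" "A \<subseteq> verts G"
  shows "digital_sphere 0 (induced G A) \<longleftrightarrow> (\<exists>a b. a \<noteq> b \<and> \<not> adjacent G a b \<and> A = {a, b})"
proof -
  have "verts G \<inter> A = A" using assms by blast
  moreover have "{e \<in> edges G. e \<subseteq> {a, b}} = {} \<longleftrightarrow> \<not> adjacent G a b" for a b
  proof -
    have "e = {a, b}" if "e \<in> edges G" "e \<subseteq> {a, b}" for e
      using digital_space_edge[OF assms(1) that(1)] that(2) digital_space_adjacent(3)[OF assms(1)]
      by (smt (verit) insert_commute insert_iff insert_subset singletonD)
    then show ?thesis by (auto simp: adjacent_def)
  qed
  ultimately have "induced G A = \<lparr>verts = {a, b}, edges = {}\<rparr> \<longleftrightarrow> \<not> adjacent G a b \<and> A = {a, b}" for a b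
    unfolding induced_def by auto
  then show ?thesis by simp
qed

text \<open>Turns the recursive sphere predicate into a property of point sets of the ambient graph,
  to which the results on relations apply.\<close>

lemma digital_sphere_1_induced:
  assumes "digital_space G" "A \<subseteq> verts G"
  shows "digital_sphere (Suc 0) (induced G A) \<longleftrightarrow> induced_cycle (adjacent G) A"
proof -
  have A: "verts G \<inter> A = A" using assms by blast
  have "rim (induced G A) v = induced G {u \<in> A. adjacent G v u}" if "v \<in> A" for v
  proof -
    have "A \<inter> (nbrs G v \<inter> A) = {u \<in> A. adjacent G v u}" by (auto simp: nbrs_eq[OF assms(1)])
    then show ?thesis using that by (simp add: rim_def nbrs_induced)
  qed
  moreover have "digital_sphere 0 (induced G {u \<in> A. adjacent G v u}) \<longleftrightarrow>
      (\<exists>a b. a \<noteq> b \<and> \<not> adjacent G a b \<and> {u \<in> A. adjacent G v u} = {a, b})" for v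
    by (rule digital_sphere_0_induced) (use assms in auto)
  ultimately show ?thesis
    using connected_graph_induced[OF assms] digital_space_induced[OF assms(1)] A
    by (simp add: induced_cycle_def del: digital_sphere.simps(1))
qed

lemma closed_manifold_2_iff:
  "closed_manifold 2 M \<longleftrightarrow> digital_space M \<and> conn_set (adjacent M) (verts M) \<and>
     (\<forall>v\<in>verts M. induced_cycle (adjacent M) {u. adjacent M v u})"
proof (cases "digital_space M")
  case True
  have "digital_sphere (Suc 0) (rim M v) \<longleftrightarrow> induced_cycle (adjacent M) {u. adjacent M v u}" for v
    unfolding rim_def nbrs_eq[OF True]
    by (rule digital_sphere_1_induced[OF True]) (use digital_space_adjacent[OF True] in blast)
  then show ?thesis
    using True connected_graph_conn_set[OF True]
    by (simp add: numeral_2_eq_2 del: digital_sphere.simps)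
qed (simp add: numeral_2_eq_2 del: digital_sphere.simps)

lemma closed_manifold_2_surface:
  assumes "closed_manifold 2 M" "finite (verts M)"
  shows "surface (adjacent M) (verts M)"
proof
  have M: "digital_space M" "conn_set (adjacent M) (verts M)"
    and link: "\<And>v. v \<in> verts M \<Longrightarrow> induced_cycle (adjacent M) {u. adjacent M v u}"
    using assms(1) by (simp_all add: closed_manifold_2_iff)
  show "finite (verts M)" "conn_set (adjacent M) (verts M)" by fact+
  show "symp (adjacent M)" by (rule sympI) (rule adjacent_sym)
  show "\<not> adjacent M u u" for u using digital_space_adjacent(3)[OF M(1)] by metis
  show "v \<in> verts M" if "adjacent M u v" for u v using digital_space_adjacent(2)[OF M(1) that] .
  show "induced_cycle (adjacent M) {u. adjacent M v u}" if "v \<in> verts M" for v by (rule link[OF that])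
qed

subsection \<open>Contractible graphs\<close>

text \<open>One deletion of \<open>x\<close> suffices: in the subgraph on \<open>insert x A\<close>,
  the rim of \<open>x\<close> is the part of its rim in \<open>A\<close>.\<close>

lemma contractible_insert:
  assumes G: "digital_space G" and x: "x \<in> verts G" "x \<notin> A" and A: "A \<subseteq> verts G"
    and "contractible_graph (induced G A)" "contractible_graph (induced G (A \<inter> nbrs G x))"
  shows "contractible_graph (induced G (insert x A))"
proof (rule contractible_graph_contractible_trans.step)
  let ?H = "induced G (insert x A)"
  have "x \<notin> nbrs G x" using digital_space_adjacent(3)[OF G] by (auto simp: nbrs_def)
  then have "insert x A \<inter> (nbrs G x \<inter> insert x A) = A \<inter> nbrs G x" by auto
  then have "rim ?H x = induced G (A \<inter> nbrs G x)"
    by (simp add: rim_def nbrs_induced)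
  then show "contractible_trans ?H (delete_point ?H x)"
    using x assms(6) digital_space_induced[OF G]
    by (intro contractible_graph_contractible_trans.delete_point) auto
  have "insert x A \<inter> (verts G \<inter> insert x A - {x}) = A" using x A by auto
  then show "contractible_graph (delete_point ?H x)"
    using assms(5) by (simp add: delete_point_def)
qed

lemma contractible_singleton:
  assumes "digital_space G" "x \<in> verts G"
  shows "contractible_graph (induced G {x})"
proof -
  have "{e \<in> edges G. e \<subseteq> {x}} = {}"
  proof (rule ccontr)
    assume "{e \<in> edges G. e \<subseteq> {x}} \<noteq> {}"
    then obtain e where e: "e \<in> edges G" "e \<subseteq> {x}" by blast
    show False
      by (rule digital_space_edge[OF assms(1) e(1)])
        (use e(2) digital_space_adjacent(3)[OF assms(1)] in auto)
  qed
  then have "one_point (induced G {x})" using assms by (simp add: one_point_def induced_def)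
  then show ?thesis by (rule contractible_graph_contractible_trans.point)
qed

text \<open>A base point \<open>y\<close> can be deleted because its rim in the cone is again a cone
  with apex \<open>x\<close>, over the smaller base \<open>A \<inter> nbrs G y\<close>.\<close>

lemma contractible_cone:
  assumes "digital_space G" "x \<in> verts G" "finite A" "A \<subseteq> nbrs G x"
  shows "contractible_graph (induced G (insert x A))"
  using assms(3,4)
proof (induction "card A" arbitrary: A rule: less_induct)
  case less
  show ?case
  proof (cases "A = {}")
    case True
    then show ?thesis using contractible_singleton assms by simp
  next
    case False
    then obtain y where y: "y \<in> A" by blast
    then have xy: "adjacent G x y" "y \<in> verts G" using less.prems by (auto simp: nbrs_def)
    have ny: "y \<notin> nbrs G y" "x \<noteq> y" "x \<in> nbrs G y"
      using digital_space_adjacent(3)[OF assms(1)] xy assms(2) adjacent_sym[OF xy(1)]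
      by (auto simp: nbrs_def)
    have "contractible_graph (induced G (insert x (A - {y})))"
      using less.hyps[of "A - {y}"] card_Diff1_less[OF less.prems(1) y] less.prems by blast
    moreover have "contractible_graph (induced G (insert x (A \<inter> nbrs G y)))"
    proof (rule less.hyps)
      show "card (A \<inter> nbrs G y) < card A"
        using less.prems(1) y ny by (intro psubset_card_mono) auto
    qed (use less.prems in auto)
    moreover have "insert x (A - {y}) \<inter> nbrs G y = insert x (A \<inter> nbrs G y)" using ny by auto
    moreover have "insert y (insert x (A - {y})) = insert x A" using y by auto
    moreover have "A \<subseteq> verts G" using less.prems by (auto simp: nbrs_def)
    ultimately show ?thesis
      using contractible_insert[OF assms(1) xy(2), of "insert x (A - {y})"] ny assms(2) by auto
  qed
qed

text \<open>A proper connected part of a cycle has a point \<open>y\<close> next to the complement.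
  Such a \<open>y\<close> is an end of the arc and can be deleted, since its rim in the arc is a
  single point unless the arc is just \<open>y\<close>.\<close>

lemma contractible_proper_arc:
  assumes G: "digital_space G" "K \<subseteq> verts G" and K: "induced_cycle (adjacent G) K"
    and "A \<subseteq> K" "A \<noteq> K" "conn_set (adjacent G) A"
  shows "contractible_graph (induced G A)"
  using assms(4-)
proof (induction "card A" arbitrary: A rule: less_induct)
  case less
  have connK: "conn_set (adjacent G) K" and finK: "finite K"
    using K by (simp_all add: induced_cycle_def)
  have "A \<noteq> {}" using less.prems by (simp add: conn_set_def)
  obtain y z where yz: "y \<in> A" "z \<in> K - A" "adjacent G y z"
    using conn_set_edge[OF connK less.prems(1) \<open>A \<noteq> {}\<close> less.prems(2)] .
  show ?case
  proof (cases "A = {y}")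
    case True
    then show ?thesis using contractible_singleton G yz less.prems by blast
  next
    case False
    then have "{y} \<noteq> A" by blast
    then obtain w where w: "w \<in> A" "w \<noteq> y" "adjacent G y w"
      using conn_set_edge[OF less.prems(3), of "{y}"] yz by blast
    have "y \<in> K" using yz less.prems by blast
    then obtain a b where "{u \<in> K. adjacent G y u} = {a, b}"
      using induced_cycle_nbrs[OF K] by metis
    moreover have "w \<in> {u \<in> K. adjacent G y u}" "z \<in> {u \<in> K. adjacent G y u}" "w \<noteq> z"
      using w yz less.prems by auto
    \<comment> \<open>One of the two cycle neighbours of \<open>y\<close> is \<open>z\<close>,
      outside \<open>A\<close>, so \<open>w\<close> is the only neighbour of \<open>y\<close> in
      \<open>A\<close>.\<close>
    ultimately have nb: "{u \<in> K. adjacent G y u} = {w, z}" by auto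
    have nbA: "(A - {y}) \<inter> nbrs G y = {w}"
      using nb w yz less.prems(1) by (auto simp: nbrs_eq[OF G(1)])
    have "conn_set (adjacent G) (A - {y})"
    proof (rule conn_setI)
      show "A - {y} \<noteq> {}" using w by blast
      fix X assume X: "X \<subseteq> A - {y}" "X \<noteq> {}"
        and cl: "\<And>u v. u \<in> X \<Longrightarrow> v \<in> A - {y} \<Longrightarrow> adjacent G u v \<Longrightarrow> v \<in> X"
      show "A - {y} \<subseteq> X"
      \<comment> \<open>A closed \<open>X\<close> containing \<open>w\<close> remains closed in
        \<open>A\<close> after adding the leaf \<open>y\<close>; one without \<open>w\<close> is
        already closed in \<open>A\<close>.\<close>
      proof (cases "w \<in> X")
        case True
        have "insert y X = A"
        proof (rule conn_set_subset[OF less.prems(3)])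
          fix u v assume uv: "u \<in> insert y X" "v \<in> A" "adjacent G u v"
          show "v \<in> insert y X"
          proof (cases "v = y \<or> u \<noteq> y")
            case True
            then show ?thesis using cl[of u v] uv by blast
          next
            case False
            then have "v \<in> (A - {y}) \<inter> nbrs G y" using uv by (simp add: nbrs_eq[OF G(1)])
            then show ?thesis using nbA \<open>w \<in> X\<close> by simp
          qed
        qed (use X yz in auto)
        then show ?thesis by blast
      next
        case False
        have "X = A"
        proof (rule conn_set_subset[OF less.prems(3)])
          fix u v assume uv: "u \<in> X" "v \<in> A" "adjacent G u v"
          have "v \<noteq> y"
            using nbA uv X False adjacent_sym[OF uv(3)] by (auto simp: nbrs_eq[OF G(1)])
          then show "v \<in> X" using cl uv by blast
        qed (use X in auto)
        then show ?thesis using X by blast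
      qed
    qed
    moreover have "card (A - {y}) < card A"
      using yz(1) less.prems(1) finK by (meson card_Diff1_less finite_subset)
    ultimately have "contractible_graph (induced G (A - {y}))"
      using less.hyps[of "A - {y}"] less.prems yz by blast
    moreover have "contractible_graph (induced G ((A - {y}) \<inter> nbrs G y))"
      unfolding nbA using contractible_singleton[OF G(1)] w G less.prems by blast
    moreover have "insert y (A - {y}) = A" using yz by blast
    moreover have "y \<in> verts G" "A - {y} \<subseteq> verts G" using less.prems G(2) yz by auto
    ultimately show ?thesis using contractible_insert[OF G(1), of y "A - {y}"] by simp
  qed
qed

declare bounded_manifold.simps [simp del]

subsection \<open>Disks inside a closed surface\<close>

lemma graph_iso_adjacent:
  assumes "digital_space G" "graph_iso f G K" "u \<in> verts G" "v \<in> verts G"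
  shows "adjacent K (f u) (f v) \<longleftrightarrow> adjacent G u v"
proof
  assume "adjacent K (f u) (f v)"
  then obtain e where e: "e \<in> edges G" "f ` e = f ` {u, v}"
    using assms(2) by (auto simp: adjacent_def graph_iso_def)
  have "inj_on f (verts G)" using assms(2) by (simp add: graph_iso_def bij_betw_def)
  moreover have "e \<subseteq> verts G" using assms(1) e(1) by (simp add: digital_space_def)
  ultimately have "e = {u, v}" using inj_on_image_eq_iff[of f "verts G" e "{u, v}"] e(2) assms by simp
  then show "adjacent G u v" using e(1) by (simp add: adjacent_def)
next
  assume "adjacent G u v"
  then have "f ` {u, v} \<in> edges K"
    using assms(2) unfolding adjacent_def graph_iso_def by blast
  then show "adjacent K (f u) (f v)" by (simp add: adjacent_def)
qed

text \<open>\<open>D\<close> is a copy under \<open>f\<close> of a closed manifold \<open>M\<close>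
  without \<open>v\<close>, and the rim of \<open>v\<close> goes to \<open>S\<close>. The local
  conditions of \<open>fills\<close> are read off from links in \<open>M\<close>: deleting
  \<open>v\<close> changes only the links of points of its rim, and these lose just
  \<open>v\<close>.\<close>

lemma disk_fills_boundary:
  fixes H :: "'a::infinite graph"
  assumes H: "closed_manifold 2 H" "finite (verts H)" and "S \<subseteq> verts H"
    and D: "belongs_to D H" "bounded_manifold 2 D (induced H S)"
  shows "surface.fills (adjacent H) (verts H) (verts D) S"
proof -
  interpret surface "adjacent H" "verts H" by (rule closed_manifold_2_surface[OF H])
  obtain M :: "'a graph" and v f where M: "closed_manifold 2 M" and v: "v \<in> verts M"
    and f: "graph_iso f (delete_point M v) D" and S: "induced H S = induced D (f ` nbrs M v)"
    using D(2) unfolding bounded_manifold.simps by blast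
  have dM: "digital_space M" and cyc: "\<And>m. m \<in> verts M \<Longrightarrow> induced_cycle (adjacent M) {u. adjacent M m u}"
    using M by (simp_all add: closed_manifold_2_iff)
  have irreflM: "\<not> adjacent M u u" for u using digital_space_adjacent(3)[OF dM] by metis
  have symM: "symp (adjacent M)" by (rule sympI) (rule adjacent_sym)
  have vM: "verts (delete_point M v) = verts M - {v}" by (auto simp: delete_point_def)
  have bij: "bij_betw f (verts M - {v}) (verts D)" using f vM by (simp add: graph_iso_def)
  have DH: "verts D \<subseteq> verts H" "D = induced H (verts D)" using D(1) by (simp_all add: belongs_to_def)
  have adj: "adjacent H (f a) (f b) \<longleftrightarrow> adjacent M a b"
    if "a \<in> verts M - {v}" "b \<in> verts M - {v}" for a b
  proof -
    have "adjacent D (f a) (f b) \<longleftrightarrow> adjacent H (f a) (f b)"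
      using that bij_betwE[OF bij] by (subst DH(2)) simp
    moreover have "digital_space (delete_point M v)"
      by (simp add: delete_point_def digital_space_induced[OF dM])
    moreover have "adjacent (delete_point M v) a b \<longleftrightarrow> adjacent M a b"
      using that by (simp add: delete_point_def)
    ultimately show ?thesis using graph_iso_adjacent[OF _ f, of a b] vM that by simp
  qed
  have inj: "f a = f b \<longleftrightarrow> a = b" if "a \<in> verts M - {v}" "b \<in> verts M - {v}" for a b
    using bij that by (auto simp: bij_betw_def inj_on_def)
  have nv: "nbrs M v = {u. adjacent M v u}" by (rule nbrs_eq[OF dM])
  have nbM: "b \<in> verts M - {v}" if "adjacent M a b" "b \<noteq> v" for a b
    using digital_space_adjacent(2)[OF dM that(1)] that(2) by blast
  have nvsub: "nbrs M v \<subseteq> verts M - {v}" using nbM irreflM unfolding nv by blast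
  have Dim: "verts D = f ` (verts M - {v})" using bij by (simp add: bij_betw_def)
  have "verts H \<inter> S = verts D \<inter> f ` nbrs M v" using arg_cong[OF S, of verts] by simp
  then have Sim: "S = f ` nbrs M v" using assms(3) nvsub Dim by blast
  have nbD: "{u. adjacent H (f m) u} \<inter> verts D = f ` ({u. adjacent M m u} - {v})"
    if "m \<in> verts M - {v}" for m
    using adj[OF that] nbM unfolding Dim by (auto simp: image_iff)
  have "u \<in> verts D" if y: "y \<in> verts D - S" "adjacent H y u" for y u
  proof -
    obtain m where m: "y = f m" "m \<in> verts M - {v}" using y(1) Dim by blast
    have "\<not> adjacent M v m" using y(1) m(1) Sim nv by blast
    then have "v \<notin> {u. adjacent M m u}" using adjacent_sym[of M m v] by blast
    then have K: "{u. adjacent H y u} \<inter> verts D = f ` {u. adjacent M m u}" (is "_ = ?K")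
      using nbD[OF m(2)] m(1) by simp
    have m': "m \<in> verts M" using m by blast
    have yV: "y \<in> verts H" using y DH by blast
    \<comment> \<open>A cycle contained in a cycle is all of it: inside the image of the link of
      \<open>m\<close> each point already has two neighbours, and the link of \<open>y\<close> in
      \<open>H\<close> allows no more.\<close>
    have "?K = {u. adjacent H y u}"
    proof (rule conn_set_subset[OF link_conn[OF yV]])
      show "?K \<subseteq> {u. adjacent H y u}" using K by blast
      show "?K \<noteq> {}" using cyc[OF m'] by (auto simp only: induced_cycle_def conn_set_def image_is_empty)
      fix p q assume p: "p \<in> ?K" "q \<in> {u. adjacent H y u}" "adjacent H p q"
      then obtain k where k: "p = f k" "adjacent M m k" by blast
      obtain a b where ab: "a \<noteq> b" "{u \<in> {u. adjacent M m u}. adjacent M k u} = {a, b}"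
        by (rule induced_cycle_nbrs[OF cyc[OF m'], of k]) (use k in auto)
      have "p \<in> {u. adjacent H y u}" using p(1) K by blast
      then obtain c d where cd: "{u \<in> {u. adjacent H y u}. adjacent H p u} = {c, d}"
        using induced_cycle_nbrs[OF link[OF yV]] by metis
      have neq: "k \<noteq> v" "a \<noteq> v" "b \<noteq> v"
        using \<open>v \<notin> {u. adjacent M m u}\<close> k ab(2) by blast+
      have in_M: "k \<in> verts M - {v}" "a \<in> verts M - {v}" "b \<in> verts M - {v}"
        using nbM neq k ab(2) by blast+
      have "f a \<noteq> f b" using inj[OF in_M(2,3)] ab(1) by simp
      moreover have "adjacent M k a" "adjacent M k b" "adjacent M m a" "adjacent M m b"
        using ab(2) by blast+
      then have "adjacent H p (f a)" "adjacent H p (f b)" "adjacent H y (f a)" "adjacent H y (f b)"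
        using adj in_M m k by simp_all
      then have "f a \<in> {c, d}" "f b \<in> {c, d}" using cd by blast+
      moreover have "q \<in> {c, d}" using cd p by blast
      ultimately have "q = f a \<or> q = f b" by force
      then show "q \<in> ?K" using ab(2) by blast
    qed
    then show ?thesis using y(2) K by blast
  qed
  moreover have "conn_set (adjacent H) ({u. adjacent H x u} \<inter> verts D)" if xS: "x \<in> S" for x
  proof -
    obtain m where m: "x = f m" "adjacent M v m" using xS Sim nv by blast
    then have m': "m \<in> verts M - {v}" using nvsub nv by blast
    have "v \<in> {u. adjacent M m u}" using adjacent_sym[OF m(2)] by simp
    then have "conn_set (adjacent M) ({u. adjacent M m u} - {v})"
      using induced_cycle_minus_point[OF cyc symM irreflM] m' by blast
    then have "conn_set (adjacent H) (f ` ({u. adjacent M m u} - {v}))"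
      by (rule conn_set_image) (use adj nbM in blast)
    then show ?thesis using nbD[OF m'] m(1) by simp
  qed
  moreover have "p = q" if pq: "x \<in> S" "a \<in> S" "adjacent H x a" "p \<in> verts D" "q \<in> verts D"
    "adjacent H x p" "adjacent H a p" "adjacent H x q" "adjacent H a q" for x a p q
  proof -
    obtain m k where m: "x = f m" "adjacent M v m" and k: "a = f k" "adjacent M v k"
      using pq(1,2) Sim nv by blast
    have m': "m \<in> verts M - {v}" and k': "k \<in> verts M - {v}" using m k nvsub nv by blast+
    obtain r s where r: "p = f r" "r \<in> verts M - {v}" and s: "q = f s" "s \<in> verts M - {v}"
      using pq(4,5) Dim by blast
    have *: "adjacent M m k" "adjacent M m r" "adjacent M k r" "adjacent M m s" "adjacent M k s"
      using pq adj m k r s m' k' by simp_all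
    \<comment> \<open>The ends \<open>m\<close> and \<open>k\<close> of an edge have exactly two
      common neighbours in \<open>M\<close>. One is \<open>v\<close>, so \<open>r\<close> and
      \<open>s\<close> are both the other one.\<close>
    obtain c d where cd: "{u \<in> {u. adjacent M m u}. adjacent M k u} = {c, d}"
      by (rule induced_cycle_nbrs[OF cyc, of m k]) (use m' * in auto)
    have "v \<in> {c, d}" using cd adjacent_sym[OF m(2)] adjacent_sym[OF k(2)] by blast
    moreover have "r \<in> {c, d}" "s \<in> {c, d}" using cd * by blast+
    moreover have "r \<noteq> v" "s \<noteq> v" using r s by blast+
    ultimately have "r = s" by blast
    then show ?thesis using r s by simp
  qed
  moreover have "S \<subseteq> verts D" using Sim Dim nvsub by blast
  ultimately show ?thesis unfolding fills_def using DH(1) by blast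
qed

section \<open>Growing a contractible set up to the complement of a point\<close>

lemma exists_contractible_complement:
  assumes H: "closed_manifold 2 H" "finite (verts H)"
    and fill: "\<And>S. S \<subseteq> verts H \<Longrightarrow> induced_cycle (adjacent H) S \<Longrightarrow>
      \<exists>D. surface.fills (adjacent H) (verts H) D S"
  shows "\<exists>c\<in>verts H. contractible_graph (induced H (verts H - {c}))"
proof -
  interpret surface "adjacent H" "verts H" by (rule closed_manifold_2_surface[OF H])
  have dH: "digital_space H" using H(1) by (simp add: closed_manifold_2_iff)
  let ?V = "verts H"
  \<comment> \<open>The growing set is \<open>?V - C\<close>. Instead of iterating, a
    \<open>good\<close> set \<open>C\<close> of least size is taken and shown to be a single
    point.\<close>
  define good where "good C \<longleftrightarrow> C \<subseteq> ?V \<and> conn_set (adjacent H) C \<and> conn_set (adjacent H) (?V - C)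
    \<and> contractible_graph (induced H (?V - C))" for C
  obtain w where w: "w \<in> ?V" using conn by (auto simp: conn_set_def)
  then have "?V - (?V - {w}) = {w}" by blast
  then have "good (?V - {w})"
    using conn_minus_point[OF w] contractible_singleton[OF dH w]
    by (simp add: good_def conn_set_singleton)
  then obtain C where "good C" and min: "\<And>C'. good C' \<Longrightarrow> card C \<le> card C'"
    using ex_has_least_nat[of good _ card] by blast
  then have C: "C \<subseteq> ?V" "conn_set (adjacent H) C" "conn_set (adjacent H) (?V - C)"
    "contractible_graph (induced H (?V - C))"
    by (simp_all add: good_def)
  have "finite C" "C \<noteq> {}" "C \<noteq> ?V" using C fin finite_subset by (auto simp: conn_set_def)
  have "\<not> card C \<ge> 2"
  proof
    assume "card C \<ge> 2"
    then obtain x y where x: "x \<in> C" "y \<in> ?V - C" "adjacent H x y" "conn_set (adjacent H) (C - {x})"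
      using boundary_non_cut_vertex[OF C(2,1) \<open>C \<noteq> ?V\<close>] by metis
    have xV: "x \<in> ?V" using x C by blast
    let ?A = "{u. adjacent H x u} - C"
    have "conn_set (adjacent H) ?A"
      using attaching_set_connected[OF fill C(3,1) x(1,4,3)] x(2) by blast
    \<comment> \<open>A neighbour of \<open>x\<close> inside \<open>C\<close> makes
      \<open>?A\<close> a proper part of the link, as \<open>contractible_proper_arc\<close>
      demands.\<close>
    moreover have "C \<noteq> {x}" using \<open>card C \<ge> 2\<close> by auto
    then obtain z where "z \<in> C" "adjacent H x z"
      using conn_set_edge[OF C(2), of "{x}"] x(1) by blast
    then have "?A \<noteq> {u. adjacent H x u}" by blast
    ultimately have "contractible_graph (induced H ?A)"
      using ends by (intro contractible_proper_arc[OF dH _ link[OF xV]]) auto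
    moreover have "?A = (?V - C) \<inter> nbrs H x" using ends by (auto simp: nbrs_eq[OF dH])
    moreover have "?V - (C - {x}) = insert x (?V - C)" using xV by blast
    moreover have "conn_set (adjacent H) (insert x (?V - C))"
      by (rule conn_set_insert[OF C(3) sym x(2) adjacent_sym[OF x(3)]])
    moreover have "contractible_graph (induced H (insert x (?V - C)))"
      using contractible_insert[OF dH xV, of "?V - C"] C(4) x(1) calculation by simp
    ultimately have "good (C - {x})" using C(1) x(4) by (auto simp: good_def)
    then show False using min card_Diff1_less[OF \<open>finite C\<close> x(1)] by fastforce
  qed
  moreover have "card C \<noteq> 0" using \<open>finite C\<close> \<open>C \<noteq> {}\<close> by simp
  ultimately have "card C = 1" by linarith
  then show ?thesis using C card_1_singletonE by (metis insert_subset)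
qed

subsection \<open>The sphere as a union of a point complement and a cone\<close>

lemma induced_cycle_cong:
  assumes "\<And>u v. u \<in> K \<Longrightarrow> v \<in> K \<Longrightarrow> E u v \<longleftrightarrow> E' u v"
  shows "induced_cycle E K \<longleftrightarrow> induced_cycle E' K"
proof -
  have "(\<exists>a b. a \<noteq> b \<and> \<not> E a b \<and> {u \<in> K. E v u} = {a, b}) \<longleftrightarrow>
      (\<exists>a b. a \<noteq> b \<and> \<not> E' a b \<and> {u \<in> K. E' v u} = {a, b})" if v: "v \<in> K" for v
  proof -
    have nb: "{u \<in> K. E v u} = {u \<in> K. E' v u}" using assms v by blast
    have "\<not> E a b \<and> {u \<in> K. E' v u} = {a, b} \<longleftrightarrow> \<not> E' a b \<and> {u \<in> K. E' v u} = {a, b}" for a b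
    proof (cases "{u \<in> K. E' v u} = {a, b}")
      case True
      then have "a \<in> K" "b \<in> K" by blast+
      then show ?thesis using assms by simp
    qed simp
    then show ?thesis unfolding nb by simp
  qed
  moreover have "conn_set E K \<longleftrightarrow> conn_set E' K" by (rule conn_set_cong) (rule assms)
  ultimately show ?thesis unfolding induced_cycle_def by simp
qed

text \<open>The join of two pairs of non-adjacent points, which is the link of an equator point in a
  suspension.\<close>

lemma induced_four_cycle:
  assumes "symp E" "\<And>u. \<not> E u u" "E a p" "E a q" "E b p" "E b q" "a \<noteq> b" "p \<noteq> q"
    and "\<not> E a b" "\<not> E p q"
  shows "induced_cycle E {a, b, p, q}"
proof -
  have sym: "E p a" "E q a" "E p b" "E q b" "\<not> E b a" "\<not> E q p"
    using assms by (meson sympD)+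
  have "conn_set E (insert q (insert b (insert p {a})))"
    by (intro conn_set_insert[OF conn_set_insert[OF conn_set_insert[OF conn_set_singleton]]])
      (use assms sym in auto)
  moreover have "insert q (insert b (insert p {a})) = {a, b, p, q}" by blast
  moreover have "{u \<in> {a, b, p, q}. E a u} = {p, q}" "{u \<in> {a, b, p, q}. E b u} = {p, q}"
    "{u \<in> {a, b, p, q}. E p u} = {a, b}" "{u \<in> {a, b, p, q}. E q u} = {a, b}"
    using assms sym by auto
  then have "\<exists>c d. c \<noteq> d \<and> \<not> E c d \<and> {u \<in> {a, b, p, q}. E v u} = {c, d}"
    if "v \<in> {a, b, p, q}" for v
    using that assms(7-10) by (elim insertE) (metis empty_iff)+
  ultimately show ?thesis by (simp add: induced_cycle_def)
qed

lemma graph_iso_id: "graph_iso id G G"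
  by (simp add: graph_iso_def)

lemma bounded_manifold_delete_point:
  assumes "closed_manifold 2 M" "v \<in> verts M" "connected_graph (delete_point M v)"
  shows "bounded_manifold 2 (delete_point M v) (induced M (nbrs M v))"
proof -
  have "digital_space M" using assms(1) by (simp add: closed_manifold_2_iff)
  then have "(verts M - {v}) \<inter> nbrs M v = nbrs M v"
    using digital_space_adjacent(3) by (fastforce simp: nbrs_def)
  then have "induced M (nbrs M v) = induced (delete_point M v) (id ` nbrs M v)"
    by (simp add: delete_point_def)
  then show ?thesis
    unfolding bounded_manifold.simps using assms graph_iso_id by blast
qed

text \<open>To count as a manifold with boundary, the cone over the rim of \<open>c\<close> must be
  a closed manifold without a point. The second apex \<open>w\<close> supplies one: the suspension
  of the rim with poles \<open>c\<close> and \<open>w\<close>. The link of a pole is the rim, and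
  the link of a rim point is the four-cycle of the poles and its two neighbours in the rim.\<close>

lemma closed_manifold_suspension:
  assumes H: "closed_manifold 2 H" "finite (verts H)" and c: "c \<in> verts H" and w: "w \<notin> verts H"
  shows "closed_manifold 2 (add_point (induced H (insert c (nbrs H c))) w (nbrs H c))"
    (is "closed_manifold 2 ?M")
proof -
  interpret surface "adjacent H" "verts H" by (rule closed_manifold_2_surface[OF H])
  have dH: "digital_space H" using H(1) by (simp add: closed_manifold_2_iff)
  define N where "N = nbrs H c"
  have N: "N = {u. adjacent H c u}" "N \<subseteq> verts H" "c \<notin> N" "w \<notin> N" "w \<noteq> c"
    using nbrs_eq[OF dH] irrefl c w by (auto simp: N_def nbrs_def)
  have vM: "verts ?M = insert w (insert c N)" using N c by (auto simp: add_point_def N_def)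
  have adj: "adjacent ?M u v \<longleftrightarrow> (adjacent H u v \<and> u \<in> insert c N \<and> v \<in> insert c N)
      \<or> (u = w \<and> v \<in> N) \<or> (v = w \<and> u \<in> N)" for u v
    by (auto simp: adjacent_def add_point_def induced_def N_def doubleton_eq_iff)
  have dM: "digital_space ?M"
    unfolding digital_space_def
  proof (intro conjI ballI)
    show "countable (verts ?M)" using N(2) fin unfolding vM
      by (meson countable_finite finite.insertI finite_subset)
    fix e assume "e \<in> edges ?M"
    then consider "e \<in> edges H" "e \<subseteq> insert c N" | x where "e = {w, x}" "x \<in> N"
      by (auto simp: add_point_def induced_def N_def)
    then have "e \<subseteq> verts ?M \<and> card e = 2"
    proof cases
      case 1
      then show ?thesis using dH unfolding vM digital_space_def by blast
    next
      case 2
      then have "w \<noteq> x" using N(4) by blast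
      then show ?thesis using 2 unfolding vM by simp
    qed
    then show "e \<subseteq> verts ?M" "card e = 2" by simp_all
  qed
  have symM: "symp (adjacent ?M)" by (rule sympI) (rule adjacent_sym)
  have irreflM: "\<not> adjacent ?M u u" for u using digital_space_adjacent(3)[OF dM] by metis
  have cycN: "induced_cycle (adjacent ?M) N"
    using link[OF c] N(1,4) induced_cycle_cong[of N "adjacent ?M" "adjacent H"] adj by auto
  then obtain y where y: "y \<in> N" and connN: "conn_set (adjacent ?M) N"
    by (auto simp only: induced_cycle_def conn_set_def)
  have yc: "adjacent ?M y c" "adjacent ?M y w" using y N adj adjacent_sym by auto
  have "conn_set (adjacent ?M) (insert w (insert c N))"
    using conn_set_insert[OF conn_set_insert[OF connN symM y yc(1)] symM _ yc(2)] y by blast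
  moreover have "induced_cycle (adjacent ?M) {u. adjacent ?M v u}" if "v \<in> verts ?M" for v
  proof -
    from that consider "v = w" | "v = c" | "v \<in> N" using vM by blast
    then show ?thesis
    proof cases
      case 1
      then have "{u. adjacent ?M v u} = N" using adj N by auto
      then show ?thesis using cycN by simp
    next
      case 2
      then have "{u. adjacent ?M v u} = N" using adj N by auto
      then show ?thesis using cycN by simp
    next
      case 3
      obtain p q where pq: "p \<noteq> q" "\<not> adjacent ?M p q" "{u \<in> N. adjacent ?M v u} = {p, q}"
        by (rule induced_cycle_nbrs[OF cycN 3])
      have "adjacent ?M v c" "adjacent ?M v w" using 3 N adj adjacent_sym by auto
      then have "{u. adjacent ?M v u} = {c, w} \<union> {u \<in> N. adjacent ?M v u}" using adj by auto
      moreover have "p \<in> N" "q \<in> N" using pq by blast+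
      then have "induced_cycle (adjacent ?M) {c, w, p, q}"
        using N pq adj by (intro induced_four_cycle[OF symM irreflM]) auto
      ultimately show ?thesis using pq(3) by (simp add: insert_commute)
    qed
  qed
  ultimately show ?thesis unfolding closed_manifold_2_iff using dM vM by simp
qed

text \<open>When the two pieces share exactly the points of \<open>B\<close>, forgetting the tags of
  the sum type is an isomorphism: \<open>glue_map\<close> tags shared points with
  \<open>Inl\<close>, so no point occurs twice.\<close>

lemma glue_isomorphic_union:
  assumes D: "digital_space D" and C: "digital_space C" and B: "B = verts D \<inter> verts C"
  shows "isomorphic (glue D C B id)
    \<lparr>verts = verts D \<union> verts C, edges = edges D \<union> edges C\<rparr>"
proof -
  let ?f = "case_sum id id"
  have g: "glue_map B id y = (if y \<in> B then Inl y else Inr y)" for y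
    using inv_into_f_f[of id B y] by (simp add: glue_map_def)
  have fg: "?f (glue_map B id y) = y" for y by (simp add: g)
  \<comment> \<open>Injectivity by an explicit left inverse: points of \<open>D\<close> return to
    \<open>Inl\<close>, all others to \<open>Inr\<close>.\<close>
  have "(\<lambda>x. if x \<in> verts D then Inl x else Inr x) (?f z) = z" if "z \<in> verts (glue D C B id)" for z
  proof -
    from that consider x where "z = Inl x" "x \<in> verts D" | y where "z = glue_map B id y" "y \<in> verts C"
      by (auto simp: glue_def)
    then show ?thesis
    proof cases
      case 2
      have "?f z = y" unfolding 2 by (rule fg)
      moreover have "z = (if y \<in> verts D then Inl y else Inr y)" using 2 B g[of y] by simp
      ultimately show ?thesis by simp
    qed simp
  qed
  then have "inj_on ?f (verts (glue D C B id))" by (rule inj_on_inverseI)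
  moreover have "?f ` verts (glue D C B id) = verts D \<union> verts C"
    by (simp add: glue_def image_Un image_image fg)
  moreover have "(\<lambda>e. ?f ` e) ` edges (glue D C B id) = edges D \<union> edges C"
    by (simp add: glue_def image_Un image_image fg)
  ultimately have "graph_iso ?f (glue D C B id) \<lparr>verts = verts D \<union> verts C, edges = edges D \<union> edges C\<rparr>"
    unfolding graph_iso_def bij_betw_def by simp
  then show ?thesis unfolding isomorphic_def by blast
qed

text \<open>The two disks are \<open>H\<close> without \<open>c\<close> and the cone over the rim of
  \<open>c\<close>. Both have that rim as boundary, so they are glued along the identity.\<close>

lemma digital_sphere_2_if_contractible_complement:
  assumes H: "closed_manifold 2 (H :: 'a::infinite graph)" "finite (verts H)" and c: "c \<in> verts H"
    and contr: "contractible_graph (induced H (verts H - {c}))"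
  shows "digital_sphere 2 H"
proof -
  interpret surface "adjacent H" "verts H" by (rule closed_manifold_2_surface[OF H])
  have dH: "digital_space H" using H(1) by (simp add: closed_manifold_2_iff)
  define N where "N = nbrs H c"
  have N: "N = {u. adjacent H c u}" "N \<subseteq> verts H" "c \<notin> N"
    using nbrs_eq[OF dH] irrefl by (auto simp: N_def nbrs_def)
  define B where "B = induced H N"
  define D where "D = delete_point H c"
  define C where "C = induced H (insert c N)"
  have "connected_graph D"
    using connected_graph_induced[OF dH, of "verts H - {c}"] conn_minus_point[OF c]
    by (simp add: D_def delete_point_def)
  then have DB: "bounded_manifold 2 D B"
    unfolding D_def B_def N_def by (rule bounded_manifold_delete_point[OF H(1) c])
  obtain w where w: "w \<notin> verts H" using H(2) infinite_UNIV ex_new_if_finite by blast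
  let ?M = "add_point C w N"
  have M: "closed_manifold 2 ?M"
    unfolding C_def N_def by (rule closed_manifold_suspension[OF H c w])
  have MC: "delete_point ?M w = C"
    using w N(2) c by (auto simp: delete_point_def add_point_def C_def induced_def)
  have nM: "nbrs ?M w = N"
    using w N(2) c by (auto simp: nbrs_def adjacent_def add_point_def C_def induced_def doubleton_eq_iff)
  have connN: "conn_set (adjacent H) N" unfolding N(1) by (rule link_conn[OF c])
  then obtain y where y: "y \<in> N" unfolding conn_set_def by (elim conjE) (meson ex_in_conv)
  then have "adjacent H c y" using N(1) by simp
  then have "conn_set (adjacent H) (insert c N)"
    using conn_set_insert[OF connN sym y] adjacent_sym by metis
  then have "connected_graph C"
    using connected_graph_induced[OF dH, of "insert c N"] N(2) c by (simp add: C_def)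
  then have "bounded_manifold 2 C (induced ?M N)"
    using bounded_manifold_delete_point[OF M, of w] MC nM by (simp add: add_point_def)
  moreover have "induced ?M N = B"
    using w N(2) by (auto simp: add_point_def B_def C_def induced_def)
  ultimately have CB: "bounded_manifold 2 C B" by simp
  have "contractible_graph C"
    unfolding C_def using N(2) fin finite_subset by (intro contractible_cone[OF dH c]) (auto simp: N_def)
  moreover have "contractible_graph D" using contr by (simp add: D_def delete_point_def)
  ultimately have "digital_disk 2 C" "digital_disk 2 D"
    using CB DB unfolding numeral_2_eq_2 digital_disk.simps(3) by blast+
  moreover have "isomorphic (glue D C (verts B) id) H"
  proof -
    have "verts B = verts D \<inter> verts C" using N by (auto simp: B_def D_def C_def delete_point_def)
    moreover have "verts D \<union> verts C = verts H"
      using N(2) c by (auto simp: D_def C_def delete_point_def)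
    moreover have "edges D \<union> edges C = edges H"
    proof -
      \<comment> \<open>No edge is lost: an edge at \<open>c\<close> lies in the cone, every other
        edge in \<open>D\<close>.\<close>
      have "e \<in> edges D \<union> edges C" if e: "e \<in> edges H" for e
      proof -
        obtain u v where uv: "e = {u, v}" "adjacent H u v" by (rule digital_space_edge[OF dH e])
        show ?thesis
        proof (cases "c \<in> e")
          case True
          then have "e \<subseteq> insert c N" using uv N(1) adjacent_sym[OF uv(2)] by auto
          then show ?thesis using e by (simp add: C_def induced_def)
        next
          case False
          then show ?thesis using e dH by (auto simp: D_def delete_point_def induced_def digital_space_def)
        qed
      qed
      then show ?thesis by (auto simp: D_def C_def delete_point_def induced_def)
    qed
    moreover have "digital_space D" "digital_space C"
      by (simp_all add: D_def C_def delete_point_def digital_space_induced[OF dH])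
    moreover from calculation have
      "\<lparr>verts = verts D \<union> verts C, edges = edges D \<union> edges C\<rparr> = H" by (cases H) simp
    ultimately show ?thesis using glue_isomorphic_union[of D C "verts B"] by metis
  qed
  ultimately show ?thesis
    using DB CB graph_iso_id[of B] unfolding numeral_2_eq_2 digital_sphere.simps(3) by blast
qed

theorem theorem5p1:
  fixes H :: "'a::infinite graph"
  assumes "finite (verts H)"
    and "closed_manifold 2 H"
    and "\<And>S. digital_sphere 1 S \<Longrightarrow> belongs_to S H \<Longrightarrow>
           \<exists>D. belongs_to D H \<and> digital_disk 2 D \<and> bounded_manifold 2 D S"
  shows "digital_sphere 2 H"
proof -
  have dH: "digital_space H" using assms(2) by (simp add: closed_manifold_2_iff)
  \<comment> \<open>The hypothesis on disks, carried over from graphs to point sets: every induced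
    cycle is filled.\<close>
  have "\<exists>D. surface.fills (adjacent H) (verts H) D S"
    if S: "S \<subseteq> verts H" "induced_cycle (adjacent H) S" for S
  proof -
    have "digital_sphere 1 (induced H S)"
      using digital_sphere_1_induced[OF dH S(1)] S(2) by (simp del: digital_sphere.simps)
    moreover have "verts H \<inter> S = S" using S(1) by blast
    then have "belongs_to (induced H S) H" by (simp add: belongs_to_def S(1))
    ultimately obtain D where "belongs_to D H" "bounded_manifold 2 D (induced H S)"
      using assms(3) by blast
    then show ?thesis using disk_fills_boundary[OF assms(2,1) S(1)] by blast
  qed
  then obtain c where "c \<in> verts H" "contractible_graph (induced H (verts H - {c}))"
    using exists_contractible_complement[OF assms(2,1)] by blast
  then show ?thesis by (rule digital_sphere_2_if_contractible_complement[OF assms(2,1)])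
qed

end
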